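(* Let $L>\pi$ and $c>1+\frac{\pi}{L-\pi}$, and let $$\phi_c(\xi)=\frac{2c\pi}{L}\left(\frac{\sinh(\eta)}{\cosh(\eta)-\cos\left(\frac{\pi\xi}{L}\right)}\right),\qquad \eta=\eta(c)=\tanh^{-1}\left(\frac{c\pi}{(c-1)L}\right).$$ Then $\phi_c$ is an even smooth periodic function with minimal period $2L$ that satisfies $$c\mathcal{H}\phi_c'+(c-1)\phi_c-\frac12\phi_c^2=0,$$ so that $u(x,t)=\phi_c(x-ct)$ is a periodic travelling wave solution of the regularized Benjamin-Ono equation $u_t+u_x+uu_x+\mathcal{H}u_{xt}=0$.
   Context: $\mathcal{H}$ is the Hilbert transform on $2L$-periodic functions: $\widehat{\mathcal{H}f}(k)=-i\,\mathrm{sgn}(k)\widehat f(k)$, where $\widehat f(k)=\frac1{2L}\int_{-L}^Lf(x)e^{-ik\pi x/L}dx$, $k\in\mathbb{Z}$; thus $\mathcal{H}\partial_x$ has Fourier symbol $\frac{\pi}{L}|k|$. *)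

theory Defs
  imports "HOL-Analysis.Analysis" "HOL-Library.Periodic_Fun"
begin

definition fourier_coeff :: "real \<Rightarrow> (real \<Rightarrow> complex) \<Rightarrow> int \<Rightarrow> complex" where
  "fourier_coeff L f k =
     1 / (2 * of_real L) *
     integral {-L..L} (\<lambda>x. f x * exp (- \<i> * of_int k * of_real pi * of_real x / of_real L))"

definition is_hilbert_transform ::
    "real \<Rightarrow> (real \<Rightarrow> complex) \<Rightarrow> (real \<Rightarrow> complex) \<Rightarrow> bool" where
  "is_hilbert_transform L f g \<longleftrightarrow>
     periodic_fun_simple f (2 * L) \<and> f absolutely_integrable_on {-L..L} \<and>
     periodic_fun_simple g (2 * L) \<and> g absolutely_integrable_on {-L..L} \<and>
     (\<forall>k. fourier_coeff L g k = - \<i> * of_int (sgn k) * fourier_coeff L f k)"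

text \<open>
  The Fourier coefficients determine the transform only almost everywhere; continuity
  selects a pointwise representative, which is unique if it exists. If there is none, the
  value is unspecified, so an equation involving it also carries the claim of existence.
\<close>

definition hilbert :: "real \<Rightarrow> (real \<Rightarrow> complex) \<Rightarrow> real \<Rightarrow> complex" where
  "hilbert L f = (THE g. continuous_on UNIV g \<and> is_hilbert_transform L f g)"

definition smooth_fun :: "(real \<Rightarrow> real) \<Rightarrow> bool" where
  "smooth_fun f \<longleftrightarrow> (\<forall>n. (deriv ^^ n) f differentiable_on UNIV)"

definition minimal_period :: "(real \<Rightarrow> real) \<Rightarrow> real \<Rightarrow> bool" where
  "minimal_period f P \<longleftrightarrow>
     P > 0 \<and> periodic_fun_simple f P \<and> (\<forall>p. 0 < p \<and> p < P \<longrightarrow> \<not> periodic_fun_simple f p)"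

definition partial_x :: "(real \<Rightarrow> real \<Rightarrow> real) \<Rightarrow> real \<Rightarrow> real \<Rightarrow> real" where
  "partial_x u x t = deriv (\<lambda>y. u y t) x"

definition partial_t :: "(real \<Rightarrow> real \<Rightarrow> real) \<Rightarrow> real \<Rightarrow> real \<Rightarrow> real" where
  "partial_t u x t = deriv (\<lambda>s. u x s) t"

text \<open>
  Classical solutions of \<open>u\<^sub>t + u\<^sub>x + u u\<^sub>x + H u\<^sub>x\<^sub>t = 0\<close>, \<open>2L\<close>-periodic in space, with
  \<open>H\<close> acting on the space variable. Since \<open>deriv\<close> is total, the existence
  of the partial derivatives is demanded explicitly.
\<close>

definition rBO_solution :: "real \<Rightarrow> (real \<Rightarrow> real \<Rightarrow> real) \<Rightarrow> bool" where
  "rBO_solution L u \<longleftrightarrow>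
     (\<forall>t. periodic_fun_simple (\<lambda>x. u x t) (2 * L)) \<and>
     (\<forall>x t. (\<lambda>y. u y t) differentiable (at x)) \<and>
     (\<forall>x t. (\<lambda>s. u x s) differentiable (at t)) \<and>
     (\<forall>x t. (\<lambda>s. partial_x u x s) differentiable (at t)) \<and>
     continuous_on UNIV (\<lambda>(x, t). partial_x u x t) \<and>
     continuous_on UNIV (\<lambda>(x, t). partial_t u x t) \<and>
     continuous_on UNIV (\<lambda>(x, t). partial_t (partial_x u) x t) \<and>
     (\<forall>x t. of_real (partial_t u x t + partial_x u x t + u x t * partial_x u x t)
            + hilbert L (\<lambda>y. of_real (partial_t (partial_x u) y t)) x = 0)"

definition wave_eta :: "real \<Rightarrow> real \<Rightarrow> real" where
  "wave_eta L c = artanh (c * pi / ((c - 1) * L))"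

definition wave_profile :: "real \<Rightarrow> real \<Rightarrow> real \<Rightarrow> real" where
  "wave_profile L c \<xi> =
     2 * c * pi / L * (sinh (wave_eta L c) / (cosh (wave_eta L c) - cos (pi * \<xi> / L)))"

end

theory Submission
  imports Defs "HOL-Complex_Analysis.Complex_Analysis"
begin

text \<open>
  With \<open>z = cis (\<pi> \<xi> / L)\<close> and \<open>q = exp (- \<eta>)\<close>, the profile is a multiple of the Poisson kernel
  \<open>Re P\<close>, where \<open>P = (1 + q z) / (1 - q z)\<close> is holomorphic beyond the closed unit disc. For a holomorphic
  \<open>A\<close> with \<open>A 0 = 0\<close>, the Hilbert transform of \<open>Re A\<close> on the circle is \<open>Im A\<close>; the angular
  derivative of a holomorphic function is such an \<open>A\<close>, so \<open>\<H> \<phi>'\<close> is explicit. As the angular derivative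
  of \<open>P\<close> is \<open>\<i> (P\<^sup>2 - 1) / 2\<close>, the profile equation reduces to \<open>\<bar>P\<bar>\<^sup>2 + 1 = 2 coth \<eta> Re P\<close>,
  the equation of the circle onto which \<open>w \<mapsto> (1 + w) / (1 - w)\<close> maps \<open>\<bar>w\<bar> = q\<close>. Differentiating the
  profile equation gives the evolution equation. Uniqueness of the continuous Hilbert transform follows
  from the Stone-Weierstrass theorem on the circle.
\<close>

section \<open>Elementary rules for Fourier coefficients\<close>

lemma fourier_coeff_cis:
  "fourier_coeff L f k =
     1 / (2 * of_real L) * integral {-L..L} (\<lambda>x. f x * cis (- (of_int k * (pi * x / L))))"
  by (simp add: fourier_coeff_def cis_conv_exp mult.assoc)

lemma continuous_on_circle [continuous_intros]: "continuous_on S (\<lambda>x. cis (pi * x / L))"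
proof -
  have "continuous_on S (\<lambda>x. cis (pi / L * x))"
    by (intro continuous_intros)
  then show ?thesis by simp
qed

lemma fourier_integrable:
  assumes "continuous_on {-L..L} f"
  shows "(\<lambda>x. f x * cis (- (of_int k * (pi * x / L)))) integrable_on {-L..L}"
proof -
  have "continuous_on {-L..L} (\<lambda>x. f x * cis (- (of_int k * pi / L * x)))"
    by (intro continuous_intros assms)
  then show ?thesis
    by (simp add: integrable_continuous_real mult.assoc)
qed

lemma fourier_coeff_add:
  assumes "continuous_on {-L..L} f" "continuous_on {-L..L} g"
  shows "fourier_coeff L (\<lambda>x. f x + g x) k = fourier_coeff L f k + fourier_coeff L g k"
  using fourier_integrable[OF assms(1)] fourier_integrable[OF assms(2)]
  by (simp add: fourier_coeff_cis distrib_right distrib_left integral_add)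

lemma fourier_coeff_cmult: "fourier_coeff L (\<lambda>x. a * f x) k = a * fourier_coeff L f k"
  by (simp add: fourier_coeff_cis mult.assoc)

lemma fourier_coeff_cnj: "fourier_coeff L (\<lambda>x. cnj (f x)) k = cnj (fourier_coeff L f (- k))"
  by (simp add: fourier_coeff_cis integral_cnj cis_cnj)

lemma fourier_coeff_shift:
  "fourier_coeff L (\<lambda>x. cis (of_int m * (pi * x / L)) * f x) k = fourier_coeff L f (k - m)"
proof -
  have "cis (of_int m * t) * y * cis (- (of_int k * t)) = y * cis (- (of_int (k - m) * t))" for t y
  proof -
    have "cis (of_int m * t) * y * cis (- (of_int k * t)) = y * cis (of_int m * t + - (of_int k * t))"
      unfolding cis_mult[symmetric] by (simp only: mult_ac)
    then show ?thesis by (simp add: algebra_simps)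
  qed
  then show ?thesis by (simp only: fourier_coeff_cis)
qed

section \<open>Uniqueness: continuous periodic functions are determined by their Fourier
  coefficients\<close>

lemma continuous_on_polynomial_circle:
  fixes p :: "complex \<Rightarrow> 'a::euclidean_space"
  assumes "polynomial_function p"
  shows "continuous_on S (\<lambda>x. p (cis (pi * x / L)))"
  by (rule continuous_on_compose2[OF continuous_on_polymonial_function[OF assms, of UNIV]
        continuous_on_circle]) simp

text \<open>On the circle a linear form is a combination of \<open>cis t\<close> and
  \<open>cis (- t)\<close>, and multiplying by these only shifts the index of the coefficients. The
  induction keeps \<open>f\<close> arbitrary, so that a product \<open>p q\<close> is treated by
  applying the hypothesis for \<open>p\<close> to the function \<open>q f\<close>.\<close>

lemma fourier_coeff_0_mult_polynomial:
  fixes p :: "complex \<Rightarrow> real"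
  assumes "real_polynomial_function p"
    and "continuous_on {-L..L} f" and "\<And>k. fourier_coeff L f k = 0"
  shows "fourier_coeff L (\<lambda>x. of_real (p (cis (pi * x / L))) * f x) k = 0"
  using assms
proof (induction arbitrary: f k)
  case (linear h)
  \<comment> \<open>\<open>h (cis t) = cos t * h 1 + sin t * h \<i>\<close> by real linearity;
    \<open>a\<close> and \<open>b\<close> arise by writing cosine and sine through
    \<open>cis t\<close> and \<open>cis (- t)\<close>.\<close>
  define a where "a = (of_real (h 1) - \<i> * of_real (h \<i>)) / 2"
  define b where "b = (of_real (h 1) + \<i> * of_real (h \<i>)) / 2"
  have h: "of_real (h (cis t)) = a * cis (of_int 1 * t) + b * cis (of_int (-1) * t)" for t
  proof -
    have "cis t = cos t *\<^sub>R 1 + sin t *\<^sub>R \<i>"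
      by (simp add: complex_eq_iff)
    then have "h (cis t) = cos t * h 1 + sin t * h \<i>"
      using linear(1) by (simp only: linear_add[OF bounded_linear.linear]
            linear_scale[OF bounded_linear.linear]) simp
    then show ?thesis by (simp add: a_def b_def complex_eq_iff field_simps)
  qed
  have "fourier_coeff L (\<lambda>x. of_real (h (cis (pi * x / L))) * f x) k =
      fourier_coeff L (\<lambda>x. a * (cis (of_int 1 * (pi * x / L)) * f x)
                         + b * (cis (of_int (-1) * (pi * x / L)) * f x)) k"
    unfolding h by (simp add: algebra_simps)
  also have "\<dots> = fourier_coeff L (\<lambda>x. a * (cis (of_int 1 * (pi * x / L)) * f x)) k
      + fourier_coeff L (\<lambda>x. b * (cis (of_int (-1) * (pi * x / L)) * f x)) k"
    \<comment> \<open>The conjugate factor \<open>cis (- (pi * x / L))\<close> is the circle map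
      with \<open>-L\<close> in place of \<open>L\<close>, whence the second continuity
      fact.\<close>
    by (rule fourier_coeff_add; intro continuous_on_mult continuous_on_const linear)
       (use continuous_on_circle[of _ L] continuous_on_circle[of _ "-L"] in simp_all)
  also have "\<dots> = 0"
    by (simp only: fourier_coeff_cmult fourier_coeff_shift linear mult_zero_right add_0_left)
  finally show ?case .
next
  case (const c)
  then show ?case by (simp add: fourier_coeff_cmult)
next
  case (add p q)
  have "continuous_on {-L..L} (\<lambda>x. of_real (r (cis (pi * x / L))) * f x)"
    if "real_polynomial_function r" for r
    using that
    by (intro continuous_on_mult continuous_on_of_real continuous_on_polynomial_circle add.prems(1))
       (simp add: real_polynomial_function_eq)
  then show ?case
    using add by (simp add: distrib_right fourier_coeff_add)
next
  case (mult p q)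
  have "continuous_on {-L..L} (\<lambda>x. of_real (q (cis (pi * x / L))) * f x)"
    using mult.hyps(2)
    by (intro continuous_on_mult continuous_on_of_real continuous_on_polynomial_circle mult.prems(1))
       (simp add: real_polynomial_function_eq)
  then show ?case
    using mult by (simp add: mult.assoc)
qed

text \<open>Moves a periodic function to the compact circle, where Stone-Weierstrass
  applies.\<close>

lemma periodic_factors_through_circle:
  fixes f :: "real \<Rightarrow> complex"
  assumes "continuous_on UNIV f" "periodic_fun_simple f (2 * L)" "L > 0"
  obtains F where "continuous_on (sphere 0 1) F" "\<And>x. F (cis (pi * x / L)) = f x"
proof
  interpret periodic_fun_simple f "2 * L" by fact
  define p where "p = (\<lambda>t. f (2 * L * t))"
  define F where "F = p \<circ> (\<lambda>z. Arg2pi z / (2 * pi))"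
  have "path p" unfolding p_def path_def
    by (intro continuous_on_compose2[OF assms(1)] continuous_intros) auto
  moreover have "pathfinish p = pathstart p"
    using plus_1[of 0] by (simp add: p_def pathfinish_def pathstart_def)
  \<comment> \<open>\<open>Arg2pi\<close> jumps at \<open>1\<close>, so \<open>F\<close> is not
    visibly continuous there. As \<open>p\<close> closes up, its trivial loop homotopy yields a
    homotopy of circle maps, whose ends are continuous.\<close>
  ultimately have "homotopic_loops UNIV p p"
    by (simp add: homotopic_loops_refl)
  from homotopic_loops_imp_homotopic_circlemaps[OF this]
  show "continuous_on (sphere 0 1) F"
    using homotopic_with_imp_continuous unfolding F_def by blast
  fix x
  define t where "t = Arg2pi (cis (pi * x / L))"
  have "cis t = cis (pi * x / L)"
    using Arg2pi_eq[of "cis (pi * x / L)"] by (simp add: t_def cis_conv_exp)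
  then have "sin t = sin (pi * x / L) \<and> cos t = cos (pi * x / L)"
    by (metis cis.sel)
  \<comment> \<open>The angles agree modulo \<open>2 * pi\<close>, which after rescaling is a shift
    of \<open>x\<close> by whole periods \<open>2 * L\<close>.\<close>
  then obtain n :: int where "t = pi * x / L + 2 * pi * n"
    unfolding sin_cos_eq_iff by auto
  then have "2 * L * (t / (2 * pi)) = x + of_int n * (2 * L)"
    using assms(3) by (simp add: field_simps)
  then show "F (cis (pi * x / L)) = f x"
    using plus_of_int[of x n] by (simp add: F_def p_def t_def)
qed

text \<open>Such an \<open>f\<close> is orthogonal to every polynomial on the circle. Approximating
  \<open>f\<close> uniformly within \<open>e\<close> by a polynomial bounds the integral of
  \<open>\<bar>f\<bar>\<^sup>2\<close> by \<open>e\<close> times that of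
  \<open>\<bar>f\<bar>\<close>, for every \<open>e > 0\<close>.\<close>

lemma continuous_fourier_coeff_0_imp_0:
  assumes "continuous_on UNIV f" "periodic_fun_simple f (2 * L)" "L > 0"
    and "\<And>k. fourier_coeff L f k = 0"
  shows "f x = 0"
proof -
  obtain F where F: "continuous_on (sphere 0 1) F" "\<And>x. F (cis (pi * x / L)) = f x"
    using periodic_factors_through_circle assms by metis
  have cf: "continuous_on {-L..L} f"
    using assms(1) continuous_on_subset by blast
  define I where "I = integral {-L..L} (\<lambda>x. norm (f x))"
  have I: "I \<ge> 0" unfolding I_def
    by (intro integral_nonneg integrable_continuous_real continuous_intros cf) auto
  have bound: "norm (integral {-L..L} (\<lambda>x. f x * cnj (f x))) \<le> e * I" if "e > 0" for e
  proof -
    obtain p where p: "polynomial_function p" "\<And>z. z \<in> sphere 0 1 \<Longrightarrow> norm (F z - p z) < e"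
      using Stone_Weierstrass_polynomial_function[OF compact_sphere F(1) \<open>e > 0\<close>] by auto
    define P where "P = (\<lambda>x. p (cis (pi * x / L)))"
    have cP: "continuous_on {-L..L} P" unfolding P_def
      by (rule continuous_on_polynomial_circle) (rule p(1))
    have cRe: "continuous_on {-L..L} (\<lambda>x. Re (P x))" and cIm: "continuous_on {-L..L} (\<lambda>x. Im (P x))"
      by (intro continuous_intros cP)+
    have re: "real_polynomial_function (\<lambda>z. Re (p z))" "real_polynomial_function (\<lambda>z. Im (p z))"
      using p(1) bounded_linear_Re bounded_linear_Im
      unfolding polynomial_function_def o_def by blast+
    \<comment> \<open>The coefficient at \<open>0\<close> is, up to a factor, the inner product of
      \<open>f\<close> with \<open>P\<close>; splitting \<open>cnj P\<close> into real and imaginary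
      parts reduces it to real polynomials.\<close>
    have "fourier_coeff L (\<lambda>x. cnj (P x) * f x) 0 =
       fourier_coeff L (\<lambda>x. of_real (Re (P x)) * f x + (- \<i>) * (of_real (Im (P x)) * f x)) 0"
      by (intro arg_cong[where f="\<lambda>g. fourier_coeff L g 0"])
         (auto simp: complex_eq_iff fun_eq_iff algebra_simps)
    also have "\<dots> = fourier_coeff L (\<lambda>x. of_real (Re (P x)) * f x) 0
        + (- \<i>) * fourier_coeff L (\<lambda>x. of_real (Im (P x)) * f x) 0"
      unfolding fourier_coeff_cmult[symmetric]
      by (rule fourier_coeff_add; intro continuous_on_mult continuous_on_of_real
            continuous_on_const cRe cIm cf)
    also have "\<dots> = 0"
      using re[THEN fourier_coeff_0_mult_polynomial, OF cf assms(4)] by (simp add: P_def)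
    finally have z: "integral {-L..L} (\<lambda>x. f x * cnj (P x)) = 0"
      using assms(3) by (simp add: fourier_coeff_cis mult.commute)
    have "integral {-L..L} (\<lambda>x. f x * cnj (f x)) =
        integral {-L..L} (\<lambda>x. f x * cnj (f x)) - integral {-L..L} (\<lambda>x. f x * cnj (P x))"
      by (simp add: z)
    also have "\<dots> = integral {-L..L} (\<lambda>x. f x * cnj (f x - P x))"
      by (subst integral_diff[symmetric])
         (intro integrable_continuous_real continuous_intros cf cP | simp add: algebra_simps)+
    also have "norm \<dots> \<le> integral {-L..L} (\<lambda>x. e * norm (f x))"
    proof (intro integral_norm_bound_integral integrable_continuous_real continuous_intros cf cP)
      fix x
      have "norm (f x - P x) \<le> e"
        using p(2)[of "cis (pi * x / L)"] F(2)[of x] by (simp add: P_def)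
      then show "norm (f x * cnj (f x - P x)) \<le> e * norm (f x)"
        by (simp add: norm_mult mult.commute[of e] mult_left_mono del: complex_cnj_diff)
    qed
    finally show ?thesis by (simp add: I_def)
  qed
  have "norm (integral {-L..L} (\<lambda>x. f x * cnj (f x))) \<le> 0"
  proof (rule field_le_epsilon)
    fix e :: real assume "e > 0"
    \<comment> \<open>The denominator is \<open>I + 1\<close> because \<open>I\<close> may be
      \<open>0\<close>.\<close>
    then have "norm (integral {-L..L} (\<lambda>x. f x * cnj (f x))) \<le> e / (I + 1) * I"
      using I by (intro bound) auto
    also have "\<dots> \<le> e"
      using I \<open>e > 0\<close> by (simp add: field_simps)
    finally show "norm (integral {-L..L} (\<lambda>x. f x * cnj (f x))) \<le> 0 + e" by simp
  qed
  moreover have "integral {-L..L} (\<lambda>x. f x * cnj (f x)) =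
      of_real (integral {-L..L} (\<lambda>x. (norm (f x))\<^sup>2))"
  proof -
    have "((\<lambda>x. (norm (f x))\<^sup>2) has_integral integral {-L..L} (\<lambda>x. (norm (f x))\<^sup>2)) {-L..L}"
      by (intro integrable_integral integrable_continuous_real continuous_intros cf)
    then have "((\<lambda>x. complex_of_real ((norm (f x))\<^sup>2)) has_integral
        of_real (integral {-L..L} (\<lambda>x. (norm (f x))\<^sup>2))) {-L..L}"
      by (rule has_integral_of_real)
    then show ?thesis
      by (intro integral_unique) (simp only: complex_norm_square)
  qed
  ultimately have "integral {-L..L} (\<lambda>x. (norm (f x))\<^sup>2) = 0"
    by simp
  moreover have "continuous_on {-L..L} (\<lambda>x. (norm (f x))\<^sup>2)"
    by (intro continuous_intros cf)
  ultimately have 0: "f x = 0" if "x \<in> {-L..L}" for x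
    using that integral_eq_0_iff[of "-L" L "\<lambda>x. (norm (f x))\<^sup>2"] assms(3) by simp
  interpret periodic_fun_simple f "2 * L" by fact
  \<comment> \<open>The number of periods by which \<open>x\<close> must be moved back to land in
    \<open>{-L..L}\<close>.\<close>
  define n where "n = \<lfloor>(x + L) / (2 * L)\<rfloor>"
  have "of_int n \<le> (x + L) / (2 * L)" "(x + L) / (2 * L) < of_int n + 1"
    unfolding n_def by linarith+
  then have "x - of_int n * (2 * L) \<in> {-L..L}"
    using assms(3) by (simp add: field_simps)
  from 0[OF this] show ?thesis by (simp add: minus_of_int)
qed

text \<open>Two continuous candidates have equal Fourier coefficients, so their difference vanishes
  identically; hence the definite description picks out \<open>g\<close>.\<close>

lemma hilbert_eqI:
  assumes "L > 0" "continuous_on UNIV g" "is_hilbert_transform L f g"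
  shows "hilbert L f = g"
  unfolding hilbert_def
proof (rule the_equality)
  fix g' assume g': "continuous_on UNIV g' \<and> is_hilbert_transform L f g'"
  have cont: "continuous_on {-L..L} g" "continuous_on {-L..L} g'"
    using assms(2) g' continuous_on_subset by blast+
  have "g' x + (-1) * g x = 0" for x
  proof (rule continuous_fourier_coeff_0_imp_0)
    show "continuous_on UNIV (\<lambda>x. g' x + (-1) * g x)"
      using assms g' by (intro continuous_intros) auto
    show "periodic_fun_simple (\<lambda>x. g' x + (-1) * g x) (2 * L)"
      using assms(3) g' unfolding is_hilbert_transform_def periodic_fun_simple_def by simp
    show "fourier_coeff L (\<lambda>x. g' x + (-1) * g x) k = 0" for k
      using assms(3) g' cont unfolding is_hilbert_transform_def
      by (subst fourier_coeff_add; (intro continuous_intros)?) (simp_all only: fourier_coeff_cmult, simp_all)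
  qed fact
  then show "g' = g" by (auto simp: fun_eq_iff)
qed (use assms in auto)

section \<open>Boundary values of holomorphic functions: Hilbert transform and derivatives\<close>

lemma cis_vector_derivative:
  assumes "(G has_field_derivative G') (at (cis (pi * x / L)))"
  shows "((\<lambda>x. G (cis (pi * x / L))) has_vector_derivative
           (\<i> * of_real (pi / L) * cis (pi * x / L) * G')) (at x within S)"
proof -
  define w where "w = \<i> * complex_of_real (pi / L)"
  have "((\<lambda>z. exp (w * z)) has_field_derivative (w * exp (w * of_real x))) (at (of_real x))"
    by (auto intro!: derivative_eq_intros)
  then have "((\<lambda>x. exp (w * of_real x)) has_vector_derivative (w * exp (w * of_real x))) (at x within S)"
    by (rule has_vector_derivative_real_field)
  then have "((\<lambda>x. cis (pi * x / L)) has_vector_derivative (w * cis (pi * x / L))) (at x within S)"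
    by (simp add: w_def cis_conv_exp mult.assoc)
  from field_vector_diff_chain_within[OF this, of G G'] assms
  show ?thesis by (simp add: o_def has_field_derivative_at_within w_def)
qed

text \<open>By Cauchy's theorem \<open>A\<close> has only positive frequencies, the factor
  \<open>cis (pi * x / L)\<close> in front of \<open>K\<close> removing frequency \<open>0\<close>;
  so \<open>cnj A\<close> has only negative ones. The multiplier is \<open>-\<i>\<close> on the
  former and \<open>\<i>\<close> on the latter, which turns \<open>(A + cnj A) / 2\<close> into
  \<open>Im A\<close>.\<close>

lemma hilbert_Re_holomorphic:
  assumes "L > 0" "r > 1" "K holomorphic_on ball 0 r"
  defines "A \<equiv> \<lambda>x. cis (pi * x / L) * K (cis (pi * x / L))"
  shows "hilbert L (\<lambda>x. of_real (Re (A x))) = (\<lambda>x. of_real (Im (A x)))"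
proof (rule hilbert_eqI)
  have "continuous_on UNIV A" unfolding A_def
    by (intro continuous_intros continuous_on_compose2[OF holomorphic_on_imp_continuous_on[OF assms(3)]])
       (use assms in auto)
  then have cA: "continuous_on S A" for S
    using continuous_on_subset by blast
  have per: "A (x + 2 * L) = A x" for x
  proof -
    have "pi * (x + 2 * L) / L = pi * x / L + 2 * pi" using assms(1) by (simp add: field_simps)
    then show ?thesis by (simp add: A_def flip: cis_mult)
  qed
  have neg: "fourier_coeff L A k = 0" if "k \<le> 0" for k
  proof -
    obtain n where n: "k = - int n" using \<open>k \<le> 0\<close> nonpos_int_cases by blast
    \<comment> \<open>Up to the factor \<open>\<i> * pi / L\<close>, the integrand of the
      coefficient at \<open>- n\<close> is the derivative along the circle of a primitive
      \<open>M\<close> of \<open>K z * z ^ n\<close>. The integral vanishes because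
      \<open>-L\<close> and \<open>L\<close> map to the same point.\<close>
    have "(\<lambda>z. K z * z ^ n) holomorphic_on ball 0 r"
      by (intro holomorphic_intros assms)
    then obtain M where M: "\<And>z. z \<in> ball 0 r \<Longrightarrow>
        (M has_field_derivative K z * z ^ n) (at z within ball 0 r)"
      using holomorphic_convex_primitive'[OF convex_ball open_ball] by blast
    have "((\<lambda>x. \<i> * of_real (pi / L) * cis (pi * x / L) * (K (cis (pi * x / L)) * cis (pi * x / L) ^ n))
       has_integral M (cis (pi * L / L)) - M (cis (pi * (-L) / L))) {-L..L}"
    proof (rule fundamental_theorem_of_calculus)
      fix x
      have "cis (pi * x / L) \<in> ball 0 r" using assms by simp
      then show "((\<lambda>x. M (cis (pi * x / L))) has_vector_derivative \<i> * of_real (pi / L) *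
          cis (pi * x / L) * (K (cis (pi * x / L)) * cis (pi * x / L) ^ n)) (at x within {-L..L})"
        using M[of "cis (pi * x / L)"] at_within_open[OF _ open_ball, of "cis (pi * x / L)" 0 r]
        by (intro cis_vector_derivative) simp
    qed (use assms in simp)
    moreover have "cis (pi * (-L) / L) = cis (pi * L / L)"
      using assms(1) by (simp add: cis.code)
    ultimately have "((\<lambda>x. \<i> * of_real (pi / L) * (A x * cis (of_int (- k) * (pi * x / L))))
       has_integral 0) {-L..L}"
      by (simp add: n A_def Complex.DeMoivre mult.assoc)
    then have "\<i> * of_real (pi / L) * integral {-L..L} (\<lambda>x. A x * cis (of_int (- k) * (pi * x / L))) = 0"
      by (metis integral_unique integral_mult_right)
    then show ?thesis
      using assms(1) by (simp add: fourier_coeff_cis)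
  qed
  have pos: "fourier_coeff L (\<lambda>x. cnj (A x)) k = 0" if "k \<ge> 0" for k
    using neg[of "-k"] that by (simp add: fourier_coeff_cnj)
  have "fourier_coeff L (\<lambda>x. of_real (Im (A x))) k =
      - \<i> * of_int (sgn k) * fourier_coeff L (\<lambda>x. of_real (Re (A x))) k" for k
  proof -
    have re: "(\<lambda>x. of_real (Re (A x))) = (\<lambda>x. (1/2) * A x + (1/2) * cnj (A x))"
      by (auto simp: fun_eq_iff complex_eq_iff)
    have im: "(\<lambda>x. of_real (Im (A x))) = (\<lambda>x. (-\<i>/2) * A x + (\<i>/2) * cnj (A x))"
      by (auto simp: fun_eq_iff complex_eq_iff)
    have comb: "fourier_coeff L (\<lambda>x. a * A x + b * cnj (A x)) k =
        a * fourier_coeff L A k + b * fourier_coeff L (\<lambda>x. cnj (A x)) k" for a b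
      by (subst fourier_coeff_add, (intro continuous_intros cA)+) (simp only: fourier_coeff_cmult)
    show ?thesis
      unfolding re im comb using neg[of k] pos[of k] by (cases "k = 0"; cases "k > 0") auto
  qed
  then show "is_hilbert_transform L (\<lambda>x. of_real (Re (A x))) (\<lambda>x. of_real (Im (A x)))"
    unfolding is_hilbert_transform_def periodic_fun_simple_def per
    by (intro conjI allI refl absolutely_integrable_continuous_real continuous_on_of_real
        continuous_on_Re continuous_on_Im cA) simp
  show "continuous_on UNIV (\<lambda>x. complex_of_real (Im (A x)))"
    by (intro continuous_intros cA)
qed fact

text \<open>The chain rule for \<open>F (cis (pi * x / L))\<close>, written as an operator on
  functions of \<open>z\<close> so that it can be iterated among holomorphic functions. Its factor
  \<open>z\<close> is the one required for the Hilbert transform of a real part.\<close>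

definition circle_deriv :: "real \<Rightarrow> (complex \<Rightarrow> complex) \<Rightarrow> complex \<Rightarrow> complex" where
  "circle_deriv L F z = \<i> * of_real (pi / L) * z * deriv F z"

lemma holomorphic_circle_deriv:
  assumes "open S" "F holomorphic_on S"
  shows "circle_deriv L F holomorphic_on S"
proof -
  have "(\<lambda>z. \<i> * of_real (pi / L) * z * deriv F z) holomorphic_on S"
    using assms by (intro holomorphic_intros)
  then show ?thesis by (simp add: circle_deriv_def[abs_def])
qed

context
  fixes L r :: real and F :: "complex \<Rightarrow> complex"
  assumes r: "r > 1" and F: "F holomorphic_on ball 0 r"
begin

lemma circle_has_vector_derivative:
  "((\<lambda>x. F (cis (pi * x / L))) has_vector_derivative circle_deriv L F (cis (pi * x / L))) (at x)"
  unfolding circle_deriv_def using r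
  by (intro cis_vector_derivative holomorphic_derivI[OF F]) auto

lemma Re_circle_has_derivative:
  "((\<lambda>x. Re (F (cis (pi * x / L)))) has_real_derivative Re (circle_deriv L F (cis (pi * x / L)))) (at x)"
  using bounded_linear.has_vector_derivative[OF bounded_linear_Re circle_has_vector_derivative]
  by (simp add: has_real_derivative_iff_has_vector_derivative)

lemma Im_circle_has_derivative:
  "((\<lambda>x. Im (F (cis (pi * x / L)))) has_real_derivative Im (circle_deriv L F (cis (pi * x / L)))) (at x)"
  using bounded_linear.has_vector_derivative[OF bounded_linear_Im circle_has_vector_derivative]
  by (simp add: has_real_derivative_iff_has_vector_derivative)

text \<open>A translation by \<open>s\<close> is a rotation of the disc, which maps
  \<open>ball 0 r\<close> to itself and is absorbed into \<open>K\<close>. The translate and the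
  factor \<open>a\<close> serve the mixed derivative of a travelling wave.\<close>

lemma hilbert_circle_deriv:
  assumes "L > 0"
  shows "hilbert L (\<lambda>y. of_real (a * Re (circle_deriv L F (cis (pi * (y - s) / L))))) =
    (\<lambda>y. of_real (a * Im (circle_deriv L F (cis (pi * (y - s) / L)))))"
proof -
  define \<zeta> where "\<zeta> = cis (- (pi * s / L))"
  define K where "K = (\<lambda>z. of_real a * \<i> * of_real (pi / L) * \<zeta> * deriv F (\<zeta> * z))"
  have "(deriv F \<circ> (\<lambda>z. \<zeta> * z)) holomorphic_on ball 0 r"
    by (rule holomorphic_on_compose_gen[OF _ holomorphic_deriv[OF F open_ball]])
       (auto intro!: holomorphic_intros simp: \<zeta>_def norm_mult)
  then have "K holomorphic_on ball 0 r"
    unfolding K_def o_def by (intro holomorphic_intros)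
  from hilbert_Re_holomorphic[OF assms r this]
  have "hilbert L (\<lambda>y. of_real (Re (cis (pi * y / L) * K (cis (pi * y / L))))) =
    (\<lambda>y. of_real (Im (cis (pi * y / L) * K (cis (pi * y / L)))))" .
  moreover have "cis (pi * y / L) * K (cis (pi * y / L)) =
      of_real a * circle_deriv L F (cis (pi * (y - s) / L))" for y
  proof -
    have "cis (pi * (y - s) / L) = \<zeta> * cis (pi * y / L)"
      by (simp add: \<zeta>_def cis_mult right_diff_distrib diff_divide_distrib)
    then show ?thesis by (simp add: K_def circle_deriv_def mult_ac)
  qed
  ultimately show ?thesis by simp
qed

end

lemma smooth_Re_circle:
  assumes "r > 1" "F holomorphic_on ball 0 r"
  shows "smooth_fun (\<lambda>x. Re (F (cis (pi * x / L))))"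
  unfolding smooth_fun_def
proof
  fix n
  have hol: "(circle_deriv L ^^ n) F holomorphic_on ball 0 r" for n
    by (induction n) (simp_all add: assms holomorphic_circle_deriv)
  have "(deriv ^^ n) (\<lambda>x. Re (F (cis (pi * x / L)))) =
      (\<lambda>x. Re ((circle_deriv L ^^ n) F (cis (pi * x / L))))"
  proof (induction n)
    case (Suc n)
    show ?case
      by (simp add: Suc fun_eq_iff DERIV_imp_deriv[OF Re_circle_has_derivative[OF assms(1) hol]])
  qed simp
  then show "(deriv ^^ n) (\<lambda>x. Re (F (cis (pi * x / L)))) differentiable_on UNIV"
    using Re_circle_has_derivative[OF assms(1) hol[of n]]
    by (auto simp: differentiable_on_def real_differentiable_def)
qed

section \<open>From the profile equation to the evolution equation\<close>

text \<open>Each time derivative contributes a factor \<open>- c\<close>, so the evolution equation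
  is the negative of the differentiated profile equation \<open>eq\<close>. Here \<open>h'\<close>
  stands for the Hilbert transform of \<open>\<phi>''\<close>.\<close>

lemma rBO_solution_travelling_wave:
  fixes \<phi> \<phi>' \<phi>'' h' :: "real \<Rightarrow> real"
  assumes per: "periodic_fun_simple \<phi> (2 * L)"
    and d1: "\<And>x. (\<phi> has_real_derivative \<phi>' x) (at x)"
    and d2: "\<And>x. (\<phi>' has_real_derivative \<phi>'' x) (at x)"
    and cont: "continuous_on UNIV \<phi>''"
    and hil: "\<And>s. hilbert L (\<lambda>y. of_real (- c * \<phi>'' (y - s))) = (\<lambda>y. of_real (- c * h' (y - s)))"
    and eq: "\<And>x. c * h' x + (c - 1) * \<phi>' x - \<phi> x * \<phi>' x = 0"
  shows "rBO_solution L (\<lambda>x t. \<phi> (x - c * t))"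
proof -
  have diff: "f differentiable (at x)" if "(f has_real_derivative D) (at x)" for f D x
    using that by (auto simp: real_differentiable_def)
  let ?u = "\<lambda>x t. \<phi> (x - c * t)"
  have x1: "((\<lambda>y. \<phi> (y - c * t)) has_real_derivative \<phi>' (x - c * t)) (at x)" for x t
    by (rule DERIV_cong[OF DERIV_chain2[OF d1]]) (auto intro!: derivative_eq_intros)
  have t1: "((\<lambda>s. \<phi> (x - c * s)) has_real_derivative (- c * \<phi>' (x - c * t))) (at t)" for x t
    by (rule DERIV_cong[OF DERIV_chain2[OF d1]]) (auto intro!: derivative_eq_intros)
  have t2: "((\<lambda>s. \<phi>' (x - c * s)) has_real_derivative (- c * \<phi>'' (x - c * t))) (at t)" for x t
    by (rule DERIV_cong[OF DERIV_chain2[OF d2]]) (auto intro!: derivative_eq_intros)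
  have ux: "partial_x ?u = (\<lambda>x t. \<phi>' (x - c * t))"
    using x1 by (auto simp: fun_eq_iff partial_x_def intro: DERIV_imp_deriv)
  have ut: "partial_t ?u = (\<lambda>x t. - c * \<phi>' (x - c * t))"
    using t1 by (auto simp: fun_eq_iff partial_t_def intro: DERIV_imp_deriv)
  have uxt: "partial_t (\<lambda>x t. \<phi>' (x - c * t)) = (\<lambda>x t. - c * \<phi>'' (x - c * t))"
    using t2 by (auto simp: fun_eq_iff partial_t_def intro: DERIV_imp_deriv)
  have c1: "continuous_on UNIV \<phi>'"
    using d2 by (meson DERIV_isCont continuous_at_imp_continuous_on)
  have c1': "continuous_on UNIV (\<lambda>(x, t). \<phi>' (x - c * t))"
    unfolding case_prod_unfold
    by (rule continuous_on_compose2[OF c1]) (auto intro!: continuous_intros)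
  have c2': "continuous_on UNIV (\<lambda>(x, t). \<phi>'' (x - c * t))"
    unfolding case_prod_unfold
    by (rule continuous_on_compose2[OF cont]) (auto intro!: continuous_intros)
  have "of_real (- c * \<phi>' \<xi> + \<phi>' \<xi> + \<phi> \<xi> * \<phi>' \<xi>) + complex_of_real (- c * h' \<xi>) = 0" for \<xi>
  proof -
    have "- c * \<phi>' \<xi> + \<phi>' \<xi> + \<phi> \<xi> * \<phi>' \<xi> + - c * h' \<xi> = 0"
      using eq[of \<xi>] by (simp add: algebra_simps)
    then show ?thesis by (metis of_real_add of_real_0)
  qed
  moreover have "periodic_fun_simple (\<lambda>x. \<phi> (x - c * t)) (2 * L)" for t
    using per unfolding periodic_fun_simple_def by (metis add_diff_eq diff_add_eq)
  ultimately show ?thesis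
    using c1' c2' x1[THEN diff] t1[THEN diff] t2[THEN diff]
    unfolding rBO_solution_def ux ut uxt hil
    by (auto simp: case_prod_unfold intro!: continuous_intros)
qed

section \<open>The Poisson kernel and the Cayley transform\<close>

text \<open>With \<open>q = exp (- \<eta>)\<close> both sides equal
  \<open>(1 - q\<^sup>2) / (1 + q\<^sup>2 - 2 * q * cos \<theta>)\<close>, whose denominator is the
  squared modulus of \<open>1 - w\<close>.\<close>

lemma poisson_kernel_eq_Re:
  fixes \<eta> \<theta> :: real
  defines "w \<equiv> of_real (exp (- \<eta>)) * cis \<theta>"
  shows "sinh \<eta> / (cosh \<eta> - cos \<theta>) = Re ((1 + w) / (1 - w))"
proof -
  define q where "q = exp (- \<eta>)"
  have q: "q > 0" "exp \<eta> = 1 / q"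
    by (simp_all add: q_def exp_minus field_simps)
  have sc: "sin \<theta> * sin \<theta> = 1 - cos \<theta> * cos \<theta>"
    using sin_cos_squared_add[of \<theta>] by (simp add: power2_eq_square)
  have "sinh \<eta> = (1 - q\<^sup>2) / (2 * q)" "cosh \<eta> - cos \<theta> = (1 + q\<^sup>2 - 2 * q * cos \<theta>) / (2 * q)"
    using q by (simp_all add: sinh_field_def cosh_field_def field_simps power2_eq_square flip: q_def)
  then have "sinh \<eta> / (cosh \<eta> - cos \<theta>) = (1 - q\<^sup>2) / (1 + q\<^sup>2 - 2 * q * cos \<theta>)"
    using q by simp
  also have "1 + q\<^sup>2 - 2 * q * cos \<theta> = (Re (1 - w))\<^sup>2 + (Im (1 - w))\<^sup>2"
    by (simp add: w_def flip: q_def) (simp add: power2_eq_square algebra_simps sc)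
  also have "1 - q\<^sup>2 = Re (1 + w) * Re (1 - w) + Im (1 + w) * Im (1 - w)"
    by (simp add: w_def flip: q_def) (simp add: power2_eq_square algebra_simps sc)
  finally show ?thesis by (simp only: Re_divide)
qed

text \<open>With \<open>D\<close> the squared modulus of \<open>1 - w\<close>, the parallelogram law
  gives \<open>\<bar>P\<bar>\<^sup>2 + 1 = 2 * (1 + q\<^sup>2) / D\<close>, while
  \<open>Re P = (1 - q\<^sup>2) / D\<close>; eliminating \<open>D\<close> leaves the claim.\<close>

lemma cayley_circle:
  assumes "norm w = q" "q < 1"
  defines "P \<equiv> (1 + w) / (1 - w)"
  shows "((Re P)\<^sup>2 + (Im P)\<^sup>2 + 1) * (1 - q\<^sup>2) = 2 * (1 + q\<^sup>2) * Re P"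
proof -
  define D where "D = (norm (1 - w))\<^sup>2"
  have "w \<noteq> 1" using assms by auto
  then have D0: "D \<noteq> 0" by (simp add: D_def)
  have q: "(Re w)\<^sup>2 + (Im w)\<^sup>2 = q\<^sup>2"
    using assms(1) by (simp flip: cmod_power2)
  have "(Re P)\<^sup>2 + (Im P)\<^sup>2 = (norm (1 + w))\<^sup>2 / D"
    unfolding cmod_power2[symmetric] P_def D_def by (simp add: norm_divide power_divide)
  moreover have "(norm (1 + w))\<^sup>2 + D = 2 * (1 + q\<^sup>2)"
    unfolding D_def cmod_power2 q[symmetric] by (simp add: power2_eq_square algebra_simps)
  ultimately have "(Re P)\<^sup>2 + (Im P)\<^sup>2 + 1 = 2 * (1 + q\<^sup>2) / D"
    using D0 by (simp add: field_simps)
  moreover have "Re P = (1 - q\<^sup>2) / D"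
    unfolding P_def D_def Re_divide cmod_power2 q[symmetric]
    by (simp add: power2_eq_square algebra_simps)
  ultimately show ?thesis by simp
qed

section \<open>The wave profile: parameters, profile equation, minimal period\<close>

theorem mainTheorem6:
  fixes L c :: real
  assumes "L > pi" and "c > 1 + pi / (L - pi)"
  shows "(\<forall>\<xi>. wave_profile L c (- \<xi>) = wave_profile L c \<xi>) \<and>
         smooth_fun (wave_profile L c) \<and>
         minimal_period (wave_profile L c) (2 * L) \<and>
         (\<forall>\<xi>. of_real c * hilbert L (\<lambda>y. of_real (deriv (wave_profile L c) y)) \<xi>
              + of_real ((c - 1) * wave_profile L c \<xi> - 1 / 2 * (wave_profile L c \<xi>)\<^sup>2) = 0) \<and>
         rBO_solution L (\<lambda>x t. wave_profile L c (x - c * t))"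
proof -
  define \<phi> where "\<phi> = wave_profile L c"
  define \<kappa> where "\<kappa> = 2 * c * pi / L"
  define T where "T = c * pi / ((c - 1) * L)"
  define \<eta> where "\<eta> = wave_eta L c"
  define q where "q = exp (- \<eta>)"
  have L: "L > 0" using assms(1) pi_gt_zero by linarith
  have "pi / (L - pi) > 0" using assms(1) by simp
  then have c: "c > 1" using assms(2) by linarith
  \<comment> \<open>Rearranged, this is \<open>c * pi < (c - 1) * L\<close>, which puts
    \<open>T\<close> in the domain of \<open>artanh\<close>.\<close>
  have "(c - 1) * (L - pi) > pi"
    using assms by (simp add: field_simps)
  then have T: "0 < T" "T < 1"
    using c L by (simp_all add: T_def field_simps)
  have \<kappa>: "\<kappa> > 0" using c L by (simp add: \<kappa>_def)
  have q2: "q\<^sup>2 = (1 - T) / (1 + T)"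
  proof -
    have "q\<^sup>2 = exp (- (2 * \<eta>))" by (simp add: q_def flip: exp_double)
    also have "2 * \<eta> = ln ((1 + T) / (1 - T))"
      by (simp add: \<eta>_def wave_eta_def artanh_def T_def)
    also have "exp (- \<dots>) = (1 - T) / (1 + T)"
      using T by (simp add: exp_minus)
    finally show ?thesis .
  qed
  have "q\<^sup>2 < 1\<^sup>2" using T by (simp add: q2)
  then have q: "0 < q" "q < 1"
    using power_less_imp_less_base[of q 2 1] by (simp_all add: q_def)
  have \<eta>: "\<eta> > 0" using q by (simp add: q_def)
  \<comment> \<open>\<open>T\<close> is \<open>tanh \<eta>\<close>, here expressed through
    \<open>q\<close>.\<close>
  have Tq: "(1 + q\<^sup>2) * T = 1 - q\<^sup>2"
    using T by (simp add: q2 field_simps)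
  \<comment> \<open>The only pole is at \<open>1 / q > 1\<close>, so \<open>F\<close> is holomorphic
    on a disc larger than the unit disc.\<close>
  define F where "F = (\<lambda>z::complex. of_real \<kappa> * ((1 + of_real q * z) / (1 - of_real q * z)))"
  define F1 where "F1 = circle_deriv L F"
  define F2 where "F2 = circle_deriv L F1"
  have ne: "1 - of_real q * z \<noteq> 0" if "z \<in> ball 0 (1 / q)" for z :: complex
  proof
    assume "1 - of_real q * z = 0"
    then have "norm (of_real q * z) = 1" by simp
    then show False using that q by (simp add: norm_mult field_simps)
  qed
  have r: "1 / q > 1" using q by simp
  have hF: "F holomorphic_on ball 0 (1 / q)"
    unfolding F_def by (intro holomorphic_intros ne)
  then have hF1: "F1 holomorphic_on ball 0 (1 / q)"
    unfolding F1_def by (intro holomorphic_circle_deriv) auto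
  have Re_F: "Re (F z) = \<kappa> * Re ((1 + of_real q * z) / (1 - of_real q * z))" for z
    by (simp only: F_def times_complex.sel Re_complex_of_real Im_complex_of_real mult_zero_left diff_zero)
  have \<phi>_Re: "\<phi> = (\<lambda>x. Re (F (cis (pi * x / L))))"
    unfolding \<phi>_def wave_profile_def
    by (simp only: poisson_kernel_eq_Re Re_F \<kappa>_def q_def \<eta>_def)
  define \<phi>' where "\<phi>' = (\<lambda>x. Re (F1 (cis (pi * x / L))))"
  define \<phi>'' where "\<phi>'' = (\<lambda>x. Re (F2 (cis (pi * x / L))))"
  define h where "h = (\<lambda>x. Im (F1 (cis (pi * x / L))))"
  define h' where "h' = (\<lambda>x. Im (F2 (cis (pi * x / L))))"
  have d1: "(\<phi> has_real_derivative \<phi>' x) (at x)" for x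
    unfolding \<phi>_Re \<phi>'_def F1_def by (rule Re_circle_has_derivative[OF r hF])
  have d2: "(\<phi>' has_real_derivative \<phi>'' x) (at x)" for x
    unfolding \<phi>'_def \<phi>''_def F2_def by (rule Re_circle_has_derivative[OF r hF1])
  have dh: "(h has_real_derivative h' x) (at x)" for x
    unfolding h_def h'_def F2_def by (rule Im_circle_has_derivative[OF r hF1])
  have hil: "hilbert L (\<lambda>y. of_real (\<phi>' y)) = (\<lambda>y. of_real (h y))"
    using hilbert_circle_deriv[OF r hF L, of 1 0] by (simp add: \<phi>'_def h_def F1_def)
  have profile_eq: "c * h x + (c - 1) * \<phi> x - 1 / 2 * (\<phi> x)\<^sup>2 = 0" for x
  proof -
    define z where "z = cis (pi * x / L)"
    define P where "P = (1 + of_real q * z) / (1 - of_real q * z)"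
    have z: "norm z = 1" by (simp add: z_def)
    then have nz: "1 - of_real q * z \<noteq> 0" using r by (intro ne) simp
    have "(F has_field_derivative of_real \<kappa> * (2 * of_real q / (1 - of_real q * z)\<^sup>2)) (at z)"
      unfolding F_def using nz
      by (auto intro!: derivative_eq_intros simp: power2_eq_square field_simps)
    then have "F1 z = \<i> * of_real (pi / L) * z * (of_real \<kappa> * (2 * of_real q / (1 - of_real q * z)\<^sup>2))"
      by (simp add: F1_def circle_deriv_def DERIV_imp_deriv)
    also have "\<dots> = \<i> * of_real (pi / L * \<kappa> / 2) * (P\<^sup>2 - 1)"
    proof -
      \<comment> \<open>A difference of squares yields the numerator \<open>4 * q * z\<close> of the
        angular derivative, which thereby becomes quadratic in \<open>P\<close>.\<close>
      have "P\<^sup>2 - 1 = ((1 + of_real q * z)\<^sup>2 - (1 - of_real q * z)\<^sup>2) / (1 - of_real q * z)\<^sup>2"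
        using nz by (simp add: P_def power_divide diff_divide_distrib)
      also have "(1 + of_real q * z)\<^sup>2 - (1 - of_real q * z)\<^sup>2 = 4 * of_real q * z"
        by (simp add: power2_eq_square algebra_simps)
      finally show ?thesis by simp
    qed
    finally have h: "h x = pi / L * \<kappa> / 2 * ((Re P)\<^sup>2 - (Im P)\<^sup>2 - 1)"
      by (simp add: h_def z_def[symmetric] power2_eq_square del: of_real_mult of_real_divide)
    have "c * h x = c * (pi / L) * (\<kappa> / 2 * ((Re P)\<^sup>2 - (Im P)\<^sup>2 - 1))"
      unfolding h by (simp only: mult.assoc times_divide_eq_right times_divide_eq_left)
    also have "c * (pi / L) = \<kappa> / 2" by (simp add: \<kappa>_def)
    finally have ch: "c * h x = \<kappa>\<^sup>2 / 4 * ((Re P)\<^sup>2 - (Im P)\<^sup>2 - 1)"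
      by (simp add: power2_eq_square)
    have \<phi>: "\<phi> x = \<kappa> * Re P"
      by (simp only: \<phi>_Re Re_F P_def z_def)
    have "((Re P)\<^sup>2 + (Im P)\<^sup>2 + 1) * (1 - q\<^sup>2) = 2 * (1 + q\<^sup>2) * Re P"
      unfolding P_def using q z by (intro cayley_circle) (simp_all add: norm_mult)
    then have "(1 + q\<^sup>2) * (((Re P)\<^sup>2 + (Im P)\<^sup>2 + 1) * T) = (1 + q\<^sup>2) * (2 * Re P)"
      by (simp add: Tq[symmetric] mult_ac)
    moreover have "1 + q\<^sup>2 \<noteq> 0" using zero_le_power2[of q] by linarith
    ultimately have PT: "((Re P)\<^sup>2 + (Im P)\<^sup>2 + 1) * T = 2 * Re P"
      using mult_left_cancel by blast
    \<comment> \<open>The choice of \<open>\<eta>\<close> enters here: it matches the amplitude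
      \<open>\<kappa>\<close> to the coefficient \<open>2 / T\<close> of the circle equation
      \<open>PT\<close>.\<close>
    have \<kappa>T: "\<kappa> = 2 * (c - 1) * T"
      using c L by (simp add: \<kappa>_def T_def field_simps)
    have "\<kappa> * ((Re P)\<^sup>2 + (Im P)\<^sup>2 + 1) = 2 * (c - 1) * (((Re P)\<^sup>2 + (Im P)\<^sup>2 + 1) * T)"
      unfolding \<kappa>T by (simp only: mult_ac)
    then have "\<kappa> * ((Re P)\<^sup>2 + (Im P)\<^sup>2 + 1) = 4 * (c - 1) * Re P"
      unfolding PT by simp
    \<comment> \<open>Subtracting half of \<open>(\<phi> x)\<^sup>2\<close> flips the sign of
      \<open>(Re P)\<^sup>2\<close>, so the quadratic terms combine to the left side of the circle
      equation.\<close>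
    moreover have "c * h x + (c - 1) * \<phi> x - 1 / 2 * (\<phi> x)\<^sup>2 =
        \<kappa> / 4 * (4 * (c - 1) * Re P - \<kappa> * ((Re P)\<^sup>2 + (Im P)\<^sup>2 + 1))"
      unfolding ch \<phi> by (simp add: field_simps power2_eq_square)
    ultimately show ?thesis by simp
  qed
  have "c * h' x + (c - 1) * \<phi>' x - \<phi> x * \<phi>' x = 0" for x
  proof -
    \<comment> \<open>The left side of the profile equation is constantly \<open>0\<close>, so its
      derivative vanishes.\<close>
    have "((\<lambda>x. c * h x + (c - 1) * \<phi> x - 1 / 2 * (\<phi> x)\<^sup>2) has_real_derivative
        c * h' x + (c - 1) * \<phi>' x - \<phi> x * \<phi>' x) (at x)"
      by (rule derivative_eq_intros d1 dh refl | simp)+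
    then show ?thesis unfolding profile_eq using DERIV_unique DERIV_const by blast
  qed
  moreover have "continuous_on UNIV \<phi>''"
    unfolding \<phi>''_def F2_def using r
    by (intro continuous_on_Re continuous_on_compose2[OF holomorphic_on_imp_continuous_on
          [OF holomorphic_circle_deriv[OF open_ball hF1]]] continuous_on_circle) auto
  moreover have "hilbert L (\<lambda>y. of_real (- c * \<phi>'' (y - s))) = (\<lambda>y. of_real (- c * h' (y - s)))" for s
    using hilbert_circle_deriv[OF r hF1 L, of "- c" s] by (simp add: \<phi>''_def h'_def F2_def)
  moreover have per: "periodic_fun_simple \<phi> (2 * L)"
  proof
    fix x
    have "pi * (x + 2 * L) / L = pi * x / L + 2 * pi" using L by (simp add: field_simps)
    then show "\<phi> (x + 2 * L) = \<phi> x" by (simp add: \<phi>_def wave_profile_def)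
  qed
  ultimately have "rBO_solution L (\<lambda>x t. \<phi> (x - c * t))"
    by (intro rBO_solution_travelling_wave[OF _ d1 d2]) auto
  moreover have "minimal_period \<phi> (2 * L)"
    unfolding minimal_period_def
  proof (intro conjI allI impI notI per)
    fix p assume p: "0 < p \<and> p < 2 * L" "periodic_fun_simple \<phi> p"
    interpret periodic_fun_simple \<phi> p by fact
    have "cosh \<eta> > 1"
      using cosh_real_strict_mono[of 0 \<eta>] \<eta> by simp
    then have D: "cosh \<eta> - cos t > 0" for t
      using cos_le_one[of t] by linarith
    \<comment> \<open>Equal values at \<open>0\<close> and \<open>p\<close> force equal
      denominators, hence \<open>cos (pi * p / L) = 1\<close>, and \<open>p\<close> would be an
      integer multiple of \<open>2 * L\<close>.\<close>
    have "\<kappa> * (sinh \<eta> / (cosh \<eta> - cos (pi * p / L))) = \<kappa> * (sinh \<eta> / (cosh \<eta> - 1))"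
      using plus_1[of 0] by (simp add: \<phi>_def wave_profile_def \<kappa>_def \<eta>_def)
    then have "cos (pi * p / L) = 1"
      using D[of "pi * p / L"] D[of 0] \<kappa> \<eta> by (simp add: field_simps)
    then obtain n :: int where "pi * p / L = of_int n * 2 * pi"
      using cos_one_2pi_int by blast
    then have "p = of_int n * (2 * L)" using L by (simp add: field_simps)
    with p L have "0 < (of_int n :: real)" "(of_int n :: real) < 1"
      by (simp_all add: zero_less_mult_iff)
    then show False by simp
  qed (use L in simp)
  moreover have "smooth_fun \<phi>"
    unfolding \<phi>_Re by (rule smooth_Re_circle[OF r hF])
  moreover have "\<phi> (- x) = \<phi> x" for x
    by (simp add: \<phi>_def wave_profile_def)
  moreover have "of_real c * hilbert L (\<lambda>y. of_real (deriv \<phi> y)) x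
      + of_real ((c - 1) * \<phi> x - 1 / 2 * (\<phi> x)\<^sup>2) = 0" for x
  proof -
    have "deriv \<phi> = \<phi>'" using d1 by (auto simp: fun_eq_iff intro: DERIV_imp_deriv)
    moreover have "complex_of_real c * of_real (h x) + of_real ((c - 1) * \<phi> x - 1 / 2 * (\<phi> x)\<^sup>2) =
        of_real (c * h x + (c - 1) * \<phi> x - 1 / 2 * (\<phi> x)\<^sup>2)"
      by simp
    ultimately show ?thesis unfolding profile_eq by (simp only: hil of_real_0)
  qed
  ultimately show ?thesis unfolding \<phi>_def by blast
qed

end
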